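(* Let $\Lambda=kQ/I$ be a bound quiver algebra with a squared-zero loop $l:i\to i$. If there is an arrow $\alpha\neq l$ with target $t(\alpha)=i$ such that $\alpha\beta\in I$ for every arrow $\beta$ of $Q$, then $\Lambda$ is not Iwanaga-Gorenstein. Furthermore, the same conclusion holds if there is an arrow $\gamma\ne l$ with source $s(\gamma)=i$ such that $\beta\gamma\in I$ for every arrow $\beta$ of $Q$.
   Context: A bound quiver algebra $\Lambda=kQ/I$ consists of a field $k$, a finite quiver $Q$ and an admissible ideal $I$ of the path algebra $kQ$ (every path occurring in an element of $I$ has length at least $2$, and $I$ contains all paths of length $N$ for some $N>1$). Paths are composed from left to right ($pq\neq0$ in $kQ$ only when the target of $p$ is the source of $q$). A squared-zero loop is an arrow $l:i\to i$ with $l^2\in I$. $\Lambda$ is Iwanaga-Gorenstein if it has finite injective dimension both as a left and as a right module over itself. *)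

theory Defs
  imports
    "Graph_Theory.Arc_Walk"
    "HOL-Algebra.QuotRing"
    "HOL-Algebra.Module"
    "HOL-Library.Poly_Mapping"
    "HOL-Library.Extended_Nat"
begin

section \<open>Modules over a not necessarily commutative ring\<close>

text \<open>The locale \<open>module\<close> of HOL-Algebra insists on a commutative base ring. We keep its
  record type but drop commutativity; the fields \<open>mult\<close> and \<open>one\<close> of a module record are junk.\<close>

locale left_module = R?: ring R + M?: abelian_group M for R (structure) and M (structure) +
  assumes smult_closed:
      "\<lbrakk>a \<in> carrier R; x \<in> carrier M\<rbrakk> \<Longrightarrow> a \<odot>\<^bsub>M\<^esub> x \<in> carrier M"
    and smult_l_distr:
      "\<lbrakk>a \<in> carrier R; b \<in> carrier R; x \<in> carrier M\<rbrakk> \<Longrightarrow>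
        (a \<oplus>\<^bsub>R\<^esub> b) \<odot>\<^bsub>M\<^esub> x = a \<odot>\<^bsub>M\<^esub> x \<oplus>\<^bsub>M\<^esub> b \<odot>\<^bsub>M\<^esub> x"
    and smult_r_distr:
      "\<lbrakk>a \<in> carrier R; x \<in> carrier M; y \<in> carrier M\<rbrakk> \<Longrightarrow>
        a \<odot>\<^bsub>M\<^esub> (x \<oplus>\<^bsub>M\<^esub> y) = a \<odot>\<^bsub>M\<^esub> x \<oplus>\<^bsub>M\<^esub> a \<odot>\<^bsub>M\<^esub> y"
    and smult_assoc:
      "\<lbrakk>a \<in> carrier R; b \<in> carrier R; x \<in> carrier M\<rbrakk> \<Longrightarrow>
        (a \<otimes>\<^bsub>R\<^esub> b) \<odot>\<^bsub>M\<^esub> x = a \<odot>\<^bsub>M\<^esub> (b \<odot>\<^bsub>M\<^esub> x)"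
    and smult_one: "x \<in> carrier M \<Longrightarrow> \<one>\<^bsub>R\<^esub> \<odot>\<^bsub>M\<^esub> x = x"

definition left_module_hom ::
  "('r, 'x) ring_scheme \<Rightarrow> ('r, 'a, 'y) module_scheme \<Rightarrow> ('r, 'b, 'z) module_scheme \<Rightarrow> ('a \<Rightarrow> 'b) set"
  where "left_module_hom R M N =
    {f \<in> carrier M \<rightarrow> carrier N.
       (\<forall>x\<in>carrier M. \<forall>y\<in>carrier M. f (x \<oplus>\<^bsub>M\<^esub> y) = f x \<oplus>\<^bsub>N\<^esub> f y) \<and>
       (\<forall>a\<in>carrier R. \<forall>x\<in>carrier M. f (a \<odot>\<^bsub>M\<^esub> x) = a \<odot>\<^bsub>N\<^esub> f x)}"

definition regular_module :: "('r, 'x) ring_scheme \<Rightarrow> ('r, 'r) module"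
  where "regular_module R =
    \<lparr>carrier = carrier R, mult = mult R, one = \<one>\<^bsub>R\<^esub>, zero = \<zero>\<^bsub>R\<^esub>, add = add R, smult = mult R\<rparr>"

definition opposite_ring :: "('r, 'x) ring_scheme \<Rightarrow> ('r, 'x) ring_scheme"
  where "opposite_ring R = R\<lparr>mult := \<lambda>x y. y \<otimes>\<^bsub>R\<^esub> x\<rparr>"


section \<open>Injective dimension\<close>

text \<open>A definition in HOL cannot quantify over modules with carriers in arbitrary types. The
  extension property is required for all monomorphisms between modules whose elements are taken
  from the type \<open>nat \<Rightarrow> 'r\<close>, where \<open>'r\<close> is the type of the elements of \<open>R\<close>. Every countably
  generated module is isomorphic to one of these; in particular \<open>R\<close> and its left ideals are
  included, so that by Baer's criterion this is injectivity in the category of all modules.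
  (If \<open>R\<close> is a finite-dimensional algebra, it is also injectivity in the category of finitely
  generated modules.)\<close>

definition injective_module :: "('r, 'x) ring_scheme \<Rightarrow> ('r, 'm) module \<Rightarrow> bool"
  where "injective_module R E \<longleftrightarrow>
    left_module R E \<and>
    (\<forall>(M :: ('r, nat \<Rightarrow> 'r) module) (N :: ('r, nat \<Rightarrow> 'r) module).
       \<forall>i f. left_module R M \<and> left_module R N \<and>
         i \<in> left_module_hom R M N \<and> inj_on i (carrier M) \<and> f \<in> left_module_hom R M E \<longrightarrow>
         (\<exists>g \<in> left_module_hom R N E. \<forall>x\<in>carrier M. g (i x) = f x))"

text \<open>\<open>0 \<rightarrow> M \<rightarrow> E 0 \<rightarrow> E 1 \<rightarrow> \<dots>\<close> with augmentation \<open>\<epsilon>\<close> and differentials \<open>d j : E j \<rightarrow> E (j + 1)\<close>.\<close>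

definition injective_resolution ::
  "('r, 'x) ring_scheme \<Rightarrow> ('r, 'a) module \<Rightarrow> ('a \<Rightarrow> 'm) \<Rightarrow> (nat \<Rightarrow> ('r, 'm) module) \<Rightarrow>
    (nat \<Rightarrow> 'm \<Rightarrow> 'm) \<Rightarrow> bool"
  where "injective_resolution R M \<epsilon> E d \<longleftrightarrow>
    (\<forall>j. injective_module R (E j)) \<and>
    \<epsilon> \<in> left_module_hom R M (E 0) \<and>
    (\<forall>j. d j \<in> left_module_hom R (E j) (E (Suc j))) \<and>
    inj_on \<epsilon> (carrier M) \<and>
    \<epsilon> ` carrier M = {x \<in> carrier (E 0). d 0 x = \<zero>\<^bsub>E 1\<^esub>} \<and>
    (\<forall>j. d j ` carrier (E j) = {x \<in> carrier (E (Suc j)). d (Suc j) x = \<zero>\<^bsub>E (Suc (Suc j))\<^esub>})"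

text \<open>The type argument is the type from which the elements of the modules in the resolutions are
  taken; it has to be large enough for the value to be the usual injective dimension (otherwise
  the value may be too large). For a finitely generated module over a finite-dimensional algebra
  \<open>nat \<Rightarrow> 'r\<close> is large enough, because minimal injective resolutions then consist of finitely
  generated modules. If there is no resolution of finite length, the infimum is \<open>\<infinity>\<close>.\<close>

definition injective_dimension ::
  "'m itself \<Rightarrow> ('r, 'x) ring_scheme \<Rightarrow> ('r, 'a) module \<Rightarrow> enat"
  where "injective_dimension T R M =
    Inf (enat ` {n. \<exists>(\<epsilon> :: 'a \<Rightarrow> 'm) E d. injective_resolution R M \<epsilon> E d \<and>
                     (\<forall>j>n. carrier (E j) = {\<zero>\<^bsub>E j\<^esub>})})"

text \<open>Right \<open>R\<close>-modules are left modules over the opposite ring. A negative statement about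
  \<open>iwanaga_gorenstein TYPE('m) R\<close> for a type variable \<open>'m\<close> excludes resolutions by modules with
  elements of any type whatsoever.\<close>

definition iwanaga_gorenstein :: "'m itself \<Rightarrow> ('r, 'x) ring_scheme \<Rightarrow> bool"
  where "iwanaga_gorenstein T R \<longleftrightarrow>
    injective_dimension T R (regular_module R) < \<infinity> \<and>
    injective_dimension T (opposite_ring R) (regular_module (opposite_ring R)) < \<infinity>"


section \<open>Path algebras and admissible ideals\<close>

text \<open>A path is a pair of its source and the list of its arrows, in the order in which they are
  traversed; \<open>(v, [])\<close> is the trivial path at the vertex \<open>v\<close>.\<close>

type_synonym ('v, 'e) path = "'v \<times> 'e list"

definition paths :: "('v, 'e) pre_digraph \<Rightarrow> ('v, 'e) path set"
  where "paths Q = {(u, p). \<exists>v. pre_digraph.awalk Q u p v}"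

definition path_target :: "('v, 'e) pre_digraph \<Rightarrow> ('v, 'e) path \<Rightarrow> 'v"
  where "path_target Q p = pre_digraph.awlast Q (fst p) (snd p)"

definition path_length :: "('v, 'e) path \<Rightarrow> nat"
  where "path_length p = length (snd p)"

definition path_mult ::
  "('v, 'e) pre_digraph \<Rightarrow> (('v, 'e) path \<Rightarrow>\<^sub>0 'k::field) \<Rightarrow> (('v, 'e) path \<Rightarrow>\<^sub>0 'k) \<Rightarrow> (('v, 'e) path \<Rightarrow>\<^sub>0 'k)"
  where "path_mult Q f g =
    (\<Sum>p\<in>Poly_Mapping.keys f. \<Sum>q\<in>Poly_Mapping.keys g.
       if path_target Q p = fst q
       then Poly_Mapping.single (fst p, snd p @ snd q) (Poly_Mapping.lookup f p * Poly_Mapping.lookup g q)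
       else 0)"

definition path_algebra :: "('v, 'e) pre_digraph \<Rightarrow> (('v, 'e) path \<Rightarrow>\<^sub>0 'k::field) ring"
  where "path_algebra Q =
    \<lparr>carrier = {f. Poly_Mapping.keys f \<subseteq> paths Q},
     mult = path_mult Q,
     one = (\<Sum>v\<in>verts Q. Poly_Mapping.single (v, []) 1),
     zero = 0,
     add = (+)\<rparr>"

definition arrow :: "('v, 'e) pre_digraph \<Rightarrow> 'e \<Rightarrow> (('v, 'e) path \<Rightarrow>\<^sub>0 'k::field)"
  where "arrow Q a = Poly_Mapping.single (tail Q a, [a]) 1"

definition admissible_ideal :: "('v, 'e) pre_digraph \<Rightarrow> (('v, 'e) path \<Rightarrow>\<^sub>0 'k::field) set \<Rightarrow> bool"
  where "admissible_ideal Q I \<longleftrightarrow>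
    ideal I (path_algebra Q) \<and>
    (\<forall>f\<in>I. \<forall>p\<in>Poly_Mapping.keys f. 2 \<le> path_length p) \<and>
    (\<exists>N>1. \<forall>p\<in>paths Q. path_length p = N \<longrightarrow> Poly_Mapping.single p 1 \<in> I)"

definition squared_zero_loop ::
  "('v, 'e) pre_digraph \<Rightarrow> (('v, 'e) path \<Rightarrow>\<^sub>0 'k::field) set \<Rightarrow> 'e \<Rightarrow> 'v \<Rightarrow> bool"
  where "squared_zero_loop Q I l i \<longleftrightarrow>
    l \<in> arcs Q \<and> tail Q l = i \<and> head Q l = i \<and>
    arrow Q l \<otimes>\<^bsub>path_algebra Q\<^esub> arrow Q l \<in> I"

text \<open>An ideal of the path algebra is automatically a linear subspace, since the scalars embed into
  the path algebra. The bound quiver algebra is the following ring.\<close>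

abbreviation bound_quiver_algebra ::
  "('v, 'e) pre_digraph \<Rightarrow> (('v, 'e) path \<Rightarrow>\<^sub>0 'k::field) set \<Rightarrow> (('v, 'e) path \<Rightarrow>\<^sub>0 'k) set ring"
  where "bound_quiver_algebra Q I \<equiv> path_algebra Q Quot I"


section \<open>Well-formedness\<close>

text \<open>The path algebra of a finite quiver is a ring, so the hypothesis \<open>ideal I (path_algebra Q)\<close> in
  \<open>admissible_ideal\<close> is not vacuous.\<close>

lemma ring_opposite_ring:
  assumes "ring R"
  shows "ring (opposite_ring R)"
proof -
  interpret ring R by fact
  show ?thesis
  proof (rule ringI)
    show "abelian_group (opposite_ring R)"
      by (rule abelian_groupI) (auto simp: opposite_ring_def a_ac intro: l_neg)
    show "Group.monoid (opposite_ring R)"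
      by (rule monoidI) (auto simp: opposite_ring_def m_assoc)
  qed (auto simp: opposite_ring_def l_distr r_distr)
qed

lemma left_module_regular_module:
  assumes "ring R"
  shows "left_module R (regular_module R)"
proof -
  interpret ring R by fact
  have "abelian_group (regular_module R)"
    by (rule abelian_groupI) (auto simp: regular_module_def a_ac intro: l_neg)
  then show ?thesis
    unfolding left_module_def left_module_axioms_def
    using assms by (auto simp: regular_module_def m_assoc l_distr r_distr)
qed

lemma path_mult_superset:
  assumes "finite A" "finite B" "Poly_Mapping.keys f \<subseteq> A" "Poly_Mapping.keys g \<subseteq> B"
  shows "path_mult Q f g =
    (\<Sum>p\<in>A. \<Sum>q\<in>B.
       if path_target Q p = fst q
       then Poly_Mapping.single (fst p, snd p @ snd q) (Poly_Mapping.lookup f p * Poly_Mapping.lookup g q)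
       else 0)"
proof -
  have *: "(\<Sum>q\<in>Poly_Mapping.keys g.
       if path_target Q p = fst q
       then Poly_Mapping.single (fst p, snd p @ snd q) (Poly_Mapping.lookup f p * Poly_Mapping.lookup g q)
       else 0) = (\<Sum>q\<in>B.
       if path_target Q p = fst q
       then Poly_Mapping.single (fst p, snd p @ snd q) (Poly_Mapping.lookup f p * Poly_Mapping.lookup g q)
       else 0)" for p
    using assms by (intro sum.mono_neutral_left) (auto simp: in_keys_iff)
  show ?thesis
    unfolding path_mult_def *
    using assms by (intro sum.mono_neutral_left) (auto simp: in_keys_iff intro!: sum.neutral)
qed

lemma path_mult_add_left: "path_mult Q (f + f') g = path_mult Q f g + path_mult Q f' g"
proof -
  let ?A = "Poly_Mapping.keys f \<union> Poly_Mapping.keys f'"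
  have "Poly_Mapping.keys (f + f') \<subseteq> ?A" by (rule Poly_Mapping.keys_add)
  then show ?thesis
    by (simp add: path_mult_superset[of ?A "Poly_Mapping.keys g"] sum.distrib[symmetric]
        Poly_Mapping.lookup_add distrib_right Poly_Mapping.single_add if_distrib cong: if_cong)
qed

lemma path_mult_add_right: "path_mult Q f (g + g') = path_mult Q f g + path_mult Q f g'"
proof -
  let ?A = "Poly_Mapping.keys g \<union> Poly_Mapping.keys g'"
  have "Poly_Mapping.keys (g + g') \<subseteq> ?A" by (rule Poly_Mapping.keys_add)
  then show ?thesis
    by (simp add: path_mult_superset[of "Poly_Mapping.keys f" ?A] sum.distrib[symmetric]
        Poly_Mapping.lookup_add distrib_left Poly_Mapping.single_add if_distrib cong: if_cong)
qed

lemma path_mult_zero [simp]: "path_mult Q 0 g = 0" "path_mult Q f 0 = 0"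
  by (simp_all add: path_mult_def)

lemma path_mult_single:
  "path_mult Q (Poly_Mapping.single p a) (Poly_Mapping.single q b) =
    (if path_target Q p = fst q then Poly_Mapping.single (fst p, snd p @ snd q) (a * b) else 0)"
  by (subst path_mult_superset[of "{p}" "{q}"]) auto

lemma path_target_append:
  "path_target Q (u, p) = v \<Longrightarrow> path_target Q (u, p @ q) = path_target Q (v, q)"
  by (cases "q = []") (auto simp: path_target_def pre_digraph.awalk_verts_conv)

lemma poly_mapping_additive_induct [case_names zero single add]:
  fixes f :: "'a \<Rightarrow>\<^sub>0 'b::ab_group_add"
  assumes "P 0" "\<And>p a. p \<in> Poly_Mapping.keys f \<Longrightarrow> P (Poly_Mapping.single p a)" "\<And>f g. P f \<Longrightarrow> P g \<Longrightarrow> P (f + g)"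
  shows "P f"
proof -
  have "P (\<Sum>p\<in>A. Poly_Mapping.single p (Poly_Mapping.lookup f p))"
    if "finite A" "A \<subseteq> Poly_Mapping.keys f" for A
    using that assms by (induction A rule: finite_induct) auto
  moreover have "(\<Sum>p\<in>Poly_Mapping.keys f. Poly_Mapping.single p (Poly_Mapping.lookup f p)) = f"
    by (rule poly_mapping_eqI)
      (auto simp: Poly_Mapping.lookup_sum Poly_Mapping.lookup_single when_def in_keys_iff)
  ultimately show ?thesis by (metis finite_keys order_refl)
qed

lemma path_mult_assoc: "path_mult Q (path_mult Q f g) h = path_mult Q f (path_mult Q g h)"
proof (induction f rule: poly_mapping_additive_induct)
  case (single p a)
  show ?case
  proof (induction g rule: poly_mapping_additive_induct)
    case (single q b)
    show ?case
    proof (induction h rule: poly_mapping_additive_induct)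
      case (single r c)
      have "path_target Q (fst p, snd p @ snd q) = path_target Q q" if "path_target Q p = fst q"
        using path_target_append[of Q "fst p" "snd p" "fst q" "snd q"] that by simp
      then show ?case by (auto simp: path_mult_single mult.assoc)
    qed (auto simp: path_mult_add_right)
  qed (auto simp: path_mult_add_right path_mult_add_left)
qed (auto simp: path_mult_add_left)

lemma path_mult_closed:
  assumes "Poly_Mapping.keys f \<subseteq> paths Q" "Poly_Mapping.keys g \<subseteq> paths Q"
  shows "Poly_Mapping.keys (path_mult Q f g) \<subseteq> paths Q"
proof -
  interpret pre_digraph Q .
  have *: "(fst p, snd p @ snd q) \<in> paths Q"
    if "p \<in> paths Q" "q \<in> paths Q" "path_target Q p = fst q" for p q
  proof -
    obtain v w where vw: "awalk (fst p) (snd p) v" "awalk (fst q) (snd q) w"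
      using \<open>p \<in> paths Q\<close> \<open>q \<in> paths Q\<close> by (auto simp: paths_def)
    have cas_app: "cas u (xs @ ys) w" if "cas u xs v" "cas v ys w" for u xs ys v w
      using that by (induction xs arbitrary: u) auto
    have cas_last: "v = awlast u xs" if "cas u xs v" for u xs v
      using that by (induction xs arbitrary: u) (auto simp: awalk_verts_conv)
    have "v = fst q"
      using vw cas_last that(3) by (auto simp: awalk_def path_target_def)
    then have "awalk (fst p) (snd p @ snd q) w"
      using vw cas_app by (auto simp: awalk_def)
    then show ?thesis by (auto simp: paths_def)
  qed
  show ?thesis
    unfolding path_mult_def
  proof (intro order_trans[OF Poly_Mapping.keys_sum] UN_least)
    fix p q assume "p \<in> Poly_Mapping.keys f" "q \<in> Poly_Mapping.keys g"
    then show "Poly_Mapping.keys (if path_target Q p = fst q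
       then Poly_Mapping.single (fst p, snd p @ snd q) (Poly_Mapping.lookup f p * Poly_Mapping.lookup g q)
       else 0) \<subseteq> paths Q"
      using *[of p q] assms by auto
  qed
qed

lemma ring_path_algebra:
  assumes "fin_digraph Q"
  shows "ring (path_algebra Q :: (('v, 'e) path \<Rightarrow>\<^sub>0 'k::field) ring)"
proof -
  interpret fin_digraph Q by fact
  let ?one = "\<Sum>v\<in>verts Q. Poly_Mapping.single (v, []) 1 :: ('v, 'e) path \<Rightarrow>\<^sub>0 'k"
  have one_keys: "Poly_Mapping.keys ?one \<subseteq> paths Q"
    by (rule order_trans[OF Poly_Mapping.keys_sum]) (auto simp: paths_def awalk_def)
  have sum_left: "path_mult Q (\<Sum>v\<in>A. F v) g = (\<Sum>v\<in>A. path_mult Q (F v) g)" for A F and g :: "('v, 'e) path \<Rightarrow>\<^sub>0 'k"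
    by (induction A rule: infinite_finite_induct) (auto simp: path_mult_add_left)
  have sum_right: "path_mult Q g (\<Sum>v\<in>A. F v) = (\<Sum>v\<in>A. path_mult Q g (F v))" for A F and g :: "('v, 'e) path \<Rightarrow>\<^sub>0 'k"
    by (induction A rule: infinite_finite_induct) (auto simp: path_mult_add_right)
  have fst_path: "fst p \<in> verts Q" if "p \<in> paths Q" for p
    using that by (auto simp: paths_def awalk_def)
  have target_path: "path_target Q p \<in> verts Q" if "p \<in> paths Q" for p
    using that by (auto simp: paths_def path_target_def awlast_in_verts)
  have one_left: "path_mult Q ?one f = f" if "Poly_Mapping.keys f \<subseteq> paths Q" for f
  proof (induction f rule: poly_mapping_additive_induct)
    case (single p a)
    then have "fst p \<in> verts Q" using fst_path that by blast
    then show ?case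
      by (simp add: sum_left path_mult_single path_target_def)
  qed (auto simp: path_mult_add_right)
  have one_right: "path_mult Q f ?one = f" if "Poly_Mapping.keys f \<subseteq> paths Q" for f
  proof (induction f rule: poly_mapping_additive_induct)
    case (single p a)
    then have "path_target Q p \<in> verts Q" using target_path that by blast
    then show ?case
      by (simp add: sum_right path_mult_single)
  qed (auto simp: path_mult_add_left)
  show ?thesis
  proof (rule ringI)
    show "abelian_group (path_algebra Q :: (('v, 'e) path \<Rightarrow>\<^sub>0 'k) ring)"
    proof (rule abelian_groupI)
      fix x :: "('v, 'e) path \<Rightarrow>\<^sub>0 'k"
      assume "x \<in> carrier (path_algebra Q)"
      then show "\<exists>y\<in>carrier (path_algebra Q). y \<oplus>\<^bsub>path_algebra Q\<^esub> x = \<zero>\<^bsub>path_algebra Q\<^esub>"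
        by (intro bexI[of _ "- x"]) (auto simp: path_algebra_def)
    qed (use Poly_Mapping.keys_add in \<open>fastforce simp: path_algebra_def ac_simps\<close>)+
    show "Group.monoid (path_algebra Q :: (('v, 'e) path \<Rightarrow>\<^sub>0 'k) ring)"
      by (rule monoidI)
        (use one_keys in \<open>simp_all add: path_algebra_def path_mult_closed path_mult_assoc one_left one_right\<close>)
  qed (auto simp: path_algebra_def path_mult_add_left path_mult_add_right)
qed

end

theory Submission
  imports Defs
begin

text \<open>Let \<open>J\<close> be the maximal ideal of \<open>\<Lambda>\<close> that belongs to the vertex \<open>i\<close>. The loop gives a self-extension
  of the simple module \<open>\<Lambda> / J\<close>, that is a homomorphism \<open>J \<rightarrow> \<Lambda> / J\<close> with \<open>l \<mapsto> 1\<close>. Consider left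
  modules and an injective resolution \<open>0 \<rightarrow> \<Lambda> \<rightarrow> E 0 \<rightarrow> E 1 \<rightarrow> \<dots>\<close>. Injectivity applied to the
  self-extension shows that every element of \<open>E j\<close> annihilated by \<open>J\<close> is a multiple \<open>l a\<close>. If the
  resolution is finite, downward induction on the degree, with \<open>l\<^sup>2 = 0\<close>, shows that every cocycle
  annihilated by \<open>J\<close> is \<open>l\<close> times a coboundary; in degree \<open>0\<close> this says that every \<open>\<gamma> \<in> \<Lambda>\<close> with
  \<open>J \<gamma> = 0\<close> lies in \<open>l \<Lambda>\<close>. An arrow \<open>\<gamma> \<noteq> l\<close> does not. The case of \<open>\<alpha>\<close> is the same argument over
  the opposite ring.\<close>

section \<open>Self-extensions and injective resolutions\<close>

lemma (in left_module) smult_l_null: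
  assumes "x \<in> carrier M" shows "\<zero>\<^bsub>R\<^esub> \<odot>\<^bsub>M\<^esub> x = \<zero>\<^bsub>M\<^esub>"
proof -
  have "\<zero>\<^bsub>R\<^esub> \<odot>\<^bsub>M\<^esub> x \<oplus>\<^bsub>M\<^esub> \<zero>\<^bsub>R\<^esub> \<odot>\<^bsub>M\<^esub> x = \<zero>\<^bsub>R\<^esub> \<odot>\<^bsub>M\<^esub> x"
    using smult_l_distr[of "\<zero>\<^bsub>R\<^esub>" "\<zero>\<^bsub>R\<^esub>" x] assms by simp
  then show ?thesis
    using assms smult_closed[of "\<zero>\<^bsub>R\<^esub>" x] by simp
qed

lemma (in left_module) smult_r_null:
  assumes "a \<in> carrier R" shows "a \<odot>\<^bsub>M\<^esub> \<zero>\<^bsub>M\<^esub> = \<zero>\<^bsub>M\<^esub>"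
proof -
  have "a \<odot>\<^bsub>M\<^esub> \<zero>\<^bsub>M\<^esub> \<oplus>\<^bsub>M\<^esub> a \<odot>\<^bsub>M\<^esub> \<zero>\<^bsub>M\<^esub> = a \<odot>\<^bsub>M\<^esub> \<zero>\<^bsub>M\<^esub>"
    using smult_r_distr[of a "\<zero>\<^bsub>M\<^esub>" "\<zero>\<^bsub>M\<^esub>"] assms by simp
  then show ?thesis
    using assms smult_closed[of a "\<zero>\<^bsub>M\<^esub>"] by simp
qed

text \<open>This turns congruences of scalars modulo \<open>J\<close> into equalities of their
  actions on elements that \<open>J\<close> kills.\<close>

lemma (in left_module) smult_eqI:
  assumes "a \<in> carrier R" "b \<in> carrier R" "x \<in> carrier M" "(a \<ominus>\<^bsub>R\<^esub> b) \<odot>\<^bsub>M\<^esub> x = \<zero>\<^bsub>M\<^esub>"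
  shows "a \<odot>\<^bsub>M\<^esub> x = b \<odot>\<^bsub>M\<^esub> x"
proof -
  have "a \<odot>\<^bsub>M\<^esub> x = ((a \<ominus>\<^bsub>R\<^esub> b) \<oplus>\<^bsub>R\<^esub> b) \<odot>\<^bsub>M\<^esub> x"
    using assms by (simp add: R.minus_eq R.a_assoc R.l_neg)
  also have "\<dots> = b \<odot>\<^bsub>M\<^esub> x"
    using assms by (simp add: smult_l_distr smult_closed)
  finally show ?thesis .
qed

lemma left_module_homD:
  assumes "f \<in> left_module_hom R M N"
  shows "x \<in> carrier M \<Longrightarrow> f x \<in> carrier N"
    and "x \<in> carrier M \<Longrightarrow> y \<in> carrier M \<Longrightarrow> f (x \<oplus>\<^bsub>M\<^esub> y) = f x \<oplus>\<^bsub>N\<^esub> f y"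
    and "a \<in> carrier R \<Longrightarrow> x \<in> carrier M \<Longrightarrow> f (a \<odot>\<^bsub>M\<^esub> x) = a \<odot>\<^bsub>N\<^esub> f x"
  using assms by (auto simp: left_module_hom_def)

lemma left_module_hom_zero:
  assumes "left_module R M" "left_module R N" "f \<in> left_module_hom R M N"
  shows "f \<zero>\<^bsub>M\<^esub> = \<zero>\<^bsub>N\<^esub>"
proof -
  interpret M: left_module R M by fact
  interpret N: left_module R N by fact
  have "f (\<zero>\<^bsub>R\<^esub> \<odot>\<^bsub>M\<^esub> \<zero>\<^bsub>M\<^esub>) = \<zero>\<^bsub>R\<^esub> \<odot>\<^bsub>N\<^esub> f \<zero>\<^bsub>M\<^esub>"
    by (rule left_module_homD(3)[OF assms(3)]) auto
  then show ?thesis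
    using left_module_homD(1)[OF assms(3)] by (simp add: M.smult_l_null N.smult_l_null)
qed

section \<open>Left ideals and the extension property of injective modules\<close>

locale left_ideal = ring R + additive_subgroup J R for R (structure) and J +
  assumes l_closed: "\<lbrakk>s \<in> carrier R; r \<in> J\<rbrakk> \<Longrightarrow> s \<otimes> r \<in> J"

text \<open>A copy of a left ideal with elements in the type demanded by \<^const>\<open>injective_module\<close>.\<close>

definition constant_module :: "('r, 'x) ring_scheme \<Rightarrow> 'r set \<Rightarrow> ('r, nat \<Rightarrow> 'r) module"
  where "constant_module R J =
    \<lparr>carrier = (\<lambda>r _. r) ` J, mult = undefined, one = undefined, zero = \<lambda>_. \<zero>\<^bsub>R\<^esub>,
     add = \<lambda>x y _. x 0 \<oplus>\<^bsub>R\<^esub> y 0, smult = \<lambda>s x _. s \<otimes>\<^bsub>R\<^esub> x 0\<rparr>"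

lemma (in left_ideal) left_module_constant_module: "left_module R (constant_module R J)"
proof -
  have "abelian_group (constant_module R J)"
  proof (rule abelian_groupI)
    fix x assume "x \<in> carrier (constant_module R J)"
    then obtain r where r: "r \<in> J" "x = (\<lambda>_. r)" by (auto simp: constant_module_def)
    then show "\<exists>y\<in>carrier (constant_module R J).
        y \<oplus>\<^bsub>constant_module R J\<^esub> x = \<zero>\<^bsub>constant_module R J\<^esub>"
      by (intro bexI[of _ "\<lambda>_. \<ominus> r"]) (auto simp: constant_module_def l_neg)
  qed (auto simp: constant_module_def a_ac)
  then show ?thesis
    unfolding left_module_def left_module_axioms_def
    by (auto simp: constant_module_def ring_axioms l_closed l_distr r_distr m_assoc)
qed

text \<open>Injectivity extends a homomorphism from \<open>J\<close> to all of \<open>R\<close>,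
  where it is determined by the image of \<open>\<one>\<close>; that image is the element
  \<open>a\<close>.\<close>

lemma (in left_ideal) extend_to_ring:
  fixes E :: "('a, 'm) module"
  assumes inj: "injective_module R E"
    and f: "\<And>r. r \<in> J \<Longrightarrow> f r \<in> carrier E"
      "\<And>r s. r \<in> J \<Longrightarrow> s \<in> J \<Longrightarrow> f (r \<oplus> s) = f r \<oplus>\<^bsub>E\<^esub> f s"
      "\<And>s r. s \<in> carrier R \<Longrightarrow> r \<in> J \<Longrightarrow> f (s \<otimes> r) = s \<odot>\<^bsub>E\<^esub> f r"
  shows "\<exists>a\<in>carrier E. \<forall>r\<in>J. r \<odot>\<^bsub>E\<^esub> a = f r"
proof -
  interpret whole: left_ideal R "carrier R"
    by unfold_locales auto
  let ?M = "constant_module R J" and ?N = "constant_module R (carrier R)"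
  \<comment> \<open>Both modules consist of constant functions, so the identity serves as the
    inclusion of \<open>J\<close> into \<open>R\<close>.\<close>
  have "(\<lambda>x. x) \<in> left_module_hom R ?M ?N" "(\<lambda>x. f (x 0)) \<in> left_module_hom R ?M E"
    using f by (auto simp: left_module_hom_def constant_module_def)
  then have "\<exists>g\<in>left_module_hom R ?N E. \<forall>x\<in>carrier ?M. g x = f (x 0)"
    using inj[unfolded injective_module_def, THEN conjunct2, THEN spec[of _ ?M], THEN spec[of _ ?N],
        THEN spec[of _ "\<lambda>x. x"], THEN spec[of _ "\<lambda>x. f (x 0)"]]
    by (simp add: left_module_constant_module whole.left_module_constant_module)
  then obtain g where g: "g \<in> left_module_hom R ?N E" "\<And>x. x \<in> carrier ?M \<Longrightarrow> g x = f (x 0)"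
    by blast
  show ?thesis
  proof (intro bexI ballI)
    show "g (\<lambda>_. \<one>) \<in> carrier E"
      by (rule left_module_homD(1)[OF g(1)]) (auto simp: constant_module_def)
    fix r assume r: "r \<in> J"
    have "r \<odot>\<^bsub>E\<^esub> g (\<lambda>_. \<one>) = g (r \<odot>\<^bsub>?N\<^esub> (\<lambda>_. \<one>))"
      using r by (intro left_module_homD(3)[OF g(1), symmetric]) (auto simp: constant_module_def)
    also have "\<dots> = f r"
      using r g(2)[of "\<lambda>_. r"] by (auto simp: constant_module_def)
    finally show "r \<odot>\<^bsub>E\<^esub> g (\<lambda>_. \<one>) = f r" .
  qed
qed

text \<open>\<open>\<phi>\<close> represents a homomorphism \<open>J \<rightarrow> R / J\<close>, i.e. a self-extension of \<open>R / J\<close>, with \<open>l \<mapsto> 1\<close>.\<close>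

locale self_extension = left_ideal +
  fixes l \<phi>
  assumes l_mem: "l \<in> J"
    and l_sq: "l \<otimes> l = \<zero>"
    and phi_closed: "r \<in> J \<Longrightarrow> \<phi> r \<in> carrier R"
    and phi_add: "\<lbrakk>r \<in> J; s \<in> J\<rbrakk> \<Longrightarrow> \<phi> (r \<oplus> s) = \<phi> r \<oplus> \<phi> s"
    and phi_mult: "\<lbrakk>s \<in> carrier R; r \<in> J\<rbrakk> \<Longrightarrow> \<phi> (s \<otimes> r) \<ominus> s \<otimes> \<phi> r \<in> J"
    and phi_l: "\<phi> l \<ominus> \<one> \<in> J"
begin

text \<open>As \<open>J\<close> kills \<open>c\<close>, only the class of \<open>\<phi> r\<close>
  modulo \<open>J\<close> matters, so \<open>r\<close> maps to \<open>\<phi> r\<close> times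
  \<open>c\<close> by a genuine homomorphism from \<open>J\<close>. Its extension to the ring
  provides \<open>a\<close>, and \<open>\<phi> l\<close> acts on \<open>c\<close> as 1.\<close>

lemma extend_along_loop:
  assumes "injective_module R E" "c \<in> carrier E" "\<And>r. r \<in> J \<Longrightarrow> r \<odot>\<^bsub>E\<^esub> c = \<zero>\<^bsub>E\<^esub>"
  shows "\<exists>a\<in>carrier E. l \<odot>\<^bsub>E\<^esub> a = c \<and> (\<forall>r\<in>J. r \<odot>\<^bsub>E\<^esub> a = \<phi> r \<odot>\<^bsub>E\<^esub> c)"
proof -
  interpret E: left_module R E
    using assms(1) by (simp add: injective_module_def)
  have "\<exists>a\<in>carrier E. \<forall>r\<in>J. r \<odot>\<^bsub>E\<^esub> a = \<phi> r \<odot>\<^bsub>E\<^esub> c"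
  proof (rule extend_to_ring[OF assms(1)])
    fix s r assume sr: "s \<in> carrier R" "r \<in> J"
    then have "\<phi> (s \<otimes> r) \<odot>\<^bsub>E\<^esub> c = (s \<otimes> \<phi> r) \<odot>\<^bsub>E\<^esub> c"
      using assms by (intro E.smult_eqI) (auto simp: phi_closed phi_mult l_closed)
    with sr show "\<phi> (s \<otimes> r) \<odot>\<^bsub>E\<^esub> c = s \<odot>\<^bsub>E\<^esub> (\<phi> r \<odot>\<^bsub>E\<^esub> c)"
      using assms by (simp add: E.smult_assoc phi_closed)
  qed (use assms in \<open>auto simp: phi_closed phi_add E.smult_closed E.smult_l_distr\<close>)
  moreover have "\<phi> l \<odot>\<^bsub>E\<^esub> c = \<one> \<odot>\<^bsub>E\<^esub> c"
    using assms by (intro E.smult_eqI) (auto simp: phi_closed phi_l l_mem)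
  ultimately show ?thesis
    using assms(2) l_mem by (metis E.smult_one)
qed

text \<open>Write \<open>c = l a\<close>. Since \<open>J\<close> maps \<open>a\<close> to multiples of the cocycle \<open>c\<close>, it annihilates \<open>d a\<close>, so
  \<open>d a = d (l b)\<close>. Then \<open>a - l b\<close> is in the image of \<open>f\<close>, and \<open>c = l (a - l b)\<close> because \<open>l\<^sup>2 = 0\<close>.\<close>

lemma factor_through_loop_step:
  assumes E: "injective_module R E" and F: "left_module R F"
    and hom: "d \<in> left_module_hom R E F"
    and exact: "{x \<in> carrier E. d x = \<zero>\<^bsub>F\<^esub>} \<subseteq> f ` carrier A"
    and complex: "\<And>x. x \<in> carrier E \<Longrightarrow> e (d x) = \<zero>\<^bsub>G\<^esub>"
    and factor: "\<And>c. \<lbrakk>c \<in> carrier F; \<forall>r\<in>J. r \<odot>\<^bsub>F\<^esub> c = \<zero>\<^bsub>F\<^esub>; e c = \<zero>\<^bsub>G\<^esub>\<rbrakk> \<Longrightarrow>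
      \<exists>b\<in>carrier E. c = l \<odot>\<^bsub>F\<^esub> d b"
    and c: "c \<in> carrier E" "\<And>r. r \<in> J \<Longrightarrow> r \<odot>\<^bsub>E\<^esub> c = \<zero>\<^bsub>E\<^esub>" "d c = \<zero>\<^bsub>F\<^esub>"
  shows "\<exists>b\<in>carrier A. c = l \<odot>\<^bsub>E\<^esub> f b"
proof -
  interpret E: left_module R E
    using E by (simp add: injective_module_def)
  interpret F: left_module R F by fact
  obtain a where a: "a \<in> carrier E" "l \<odot>\<^bsub>E\<^esub> a = c" "\<And>r. r \<in> J \<Longrightarrow> r \<odot>\<^bsub>E\<^esub> a = \<phi> r \<odot>\<^bsub>E\<^esub> c"
    using extend_along_loop[OF E c(1,2)] by blast
  note d = left_module_homD[OF hom]
  have lR: "l \<in> carrier R" using l_mem by simp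
  have "r \<odot>\<^bsub>F\<^esub> d a = \<zero>\<^bsub>F\<^esub>" if r: "r \<in> J" for r
  proof -
    have "r \<odot>\<^bsub>F\<^esub> d a = d (\<phi> r \<odot>\<^bsub>E\<^esub> c)"
      using a r by (simp flip: d(3))
    also have "\<dots> = \<zero>\<^bsub>F\<^esub>"
      using r c by (simp add: d(3) phi_closed F.smult_r_null)
    finally show ?thesis .
  qed
  then obtain b where b: "b \<in> carrier E" "d a = l \<odot>\<^bsub>F\<^esub> d b"
    using factor[of "d a"] a complex d(1) by blast
  let ?lb = "l \<odot>\<^bsub>E\<^esub> b"
  have lb: "?lb \<in> carrier E" "\<ominus>\<^bsub>E\<^esub> ?lb \<in> carrier E"
    using b lR by (auto simp: E.smult_closed)
  \<comment> \<open>\<open>d a\<close> equals \<open>d ?lb\<close>, so \<open>a\<close> can be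
    traded for \<open>?lb\<close> before the two summands are rejoined to \<open>d\<close> of
    zero.\<close>
  have "d (a \<oplus>\<^bsub>E\<^esub> \<ominus>\<^bsub>E\<^esub> ?lb) = d ?lb \<oplus>\<^bsub>F\<^esub> d (\<ominus>\<^bsub>E\<^esub> ?lb)"
    using a b lb lR by (simp add: d(2,3))
  also have "\<dots> = d (?lb \<oplus>\<^bsub>E\<^esub> \<ominus>\<^bsub>E\<^esub> ?lb)"
    using lb by (simp add: d(2))
  also have "\<dots> = \<zero>\<^bsub>F\<^esub>"
    using lb by (simp add: E.M.r_neg left_module_hom_zero[OF E.left_module_axioms F hom])
  finally obtain x where x: "x \<in> carrier A" "a \<oplus>\<^bsub>E\<^esub> \<ominus>\<^bsub>E\<^esub> ?lb = f x"
    using exact a lb by blast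
  have "l \<odot>\<^bsub>E\<^esub> ?lb = \<zero>\<^bsub>E\<^esub>"
    using b lR by (simp add: l_sq E.smult_l_null flip: E.smult_assoc)
  moreover have "l \<odot>\<^bsub>E\<^esub> (\<ominus>\<^bsub>E\<^esub> ?lb \<oplus>\<^bsub>E\<^esub> ?lb) = \<zero>\<^bsub>E\<^esub>"
    using lb lR by (simp add: E.M.l_neg E.smult_r_null)
  ultimately have "l \<odot>\<^bsub>E\<^esub> (\<ominus>\<^bsub>E\<^esub> ?lb) = \<zero>\<^bsub>E\<^esub>"
    using lb lR by (simp add: E.smult_r_distr E.smult_closed)
  then have "l \<odot>\<^bsub>E\<^esub> f x = c"
    using a lb lR c(1) by (simp add: E.smult_r_distr flip: x(2))
  with x(1) show ?thesis by auto
qed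

text \<open>In a finite resolution the factorization through the loop descends from the degrees
  where the modules vanish to degree 0. Injectivity of \<open>\<epsilon>\<close> then pulls it back
  to the ring.\<close>

lemma injective_dimension_finite_imp_factor:
  assumes fin: "injective_dimension TYPE('m) R (regular_module R) < \<infinity>"
    and \<alpha>: "\<alpha> \<in> carrier R" "\<And>r. r \<in> J \<Longrightarrow> r \<otimes> \<alpha> = \<zero>"
  shows "\<exists>x\<in>carrier R. \<alpha> = l \<otimes> x"
proof -
  let ?M = "regular_module R"
  have M: "left_module R ?M" by (rule left_module_regular_module[OF ring_axioms])
  let ?P = "\<lambda>n. \<exists>(\<epsilon> :: 'a \<Rightarrow> 'm) E d. injective_resolution R ?M \<epsilon> E d \<and>
    (\<forall>j>n. carrier (E j) = {\<zero>\<^bsub>E j\<^esub>})"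
  \<comment> \<open>The infimum of the empty set is \<open>\<infinity>\<close>, so a finite
    dimension yields an actual resolution.\<close>
  have "{n. ?P n} \<noteq> {}"
  proof
    assume "{n. ?P n} = {}"
    then have "injective_dimension TYPE('m) R ?M = \<infinity>"
      unfolding injective_dimension_def by (simp only: image_empty Inf_empty top_enat_def)
    with fin show False by simp
  qed
  then obtain n and \<epsilon> :: "'a \<Rightarrow> 'm" and E d where res: "injective_resolution R ?M \<epsilon> E d"
    and triv: "\<And>j. j > n \<Longrightarrow> carrier (E j) = {\<zero>\<^bsub>E j\<^esub>}"
    by blast
  have inj: "injective_module R (E j)" and d: "d j \<in> left_module_hom R (E j) (E (Suc j))"
    and ex: "d j ` carrier (E j) = {x \<in> carrier (E (Suc j)). d (Suc j) x = \<zero>\<^bsub>E (Suc (Suc j))\<^esub>}" for j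
    using res unfolding injective_resolution_def by auto
  have \<epsilon>: "\<epsilon> \<in> left_module_hom R ?M (E 0)" "inj_on \<epsilon> (carrier ?M)"
    and ex0: "\<epsilon> ` carrier ?M = {x \<in> carrier (E 0). d 0 x = \<zero>\<^bsub>E (Suc 0)\<^esub>}"
    using res unfolding injective_resolution_def by auto
  have E: "left_module R (E j)" for j
    using inj by (simp add: injective_module_def)
  \<comment> \<open>Downward induction on the degree: \<open>k\<close> bounds how far
    \<open>j\<close> lies below \<open>n\<close>.\<close>
  have factor: "\<exists>b\<in>carrier (E j). c = l \<odot>\<^bsub>E (Suc j)\<^esub> d j b"
    if "n \<le> j + k" "c \<in> carrier (E (Suc j))" "\<forall>r\<in>J. r \<odot>\<^bsub>E (Suc j)\<^esub> c = \<zero>\<^bsub>E (Suc j)\<^esub>"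
      "d (Suc j) c = \<zero>\<^bsub>E (Suc (Suc j))\<^esub>" for c j k
    using that
  proof (induction k arbitrary: j c)
    case 0
    interpret Ej: left_module R "E j" by (rule E)
    interpret ESj: left_module R "E (Suc j)" by (rule E)
    \<comment> \<open>Here \<open>n \<le> j\<close>, so \<open>E (Suc j)\<close> is the zero module
      and zero is a sufficient witness.\<close>
    have "l \<odot>\<^bsub>E (Suc j)\<^esub> d j \<zero>\<^bsub>E j\<^esub> \<in> carrier (E (Suc j))"
      using left_module_homD(1)[OF d] l_mem by (auto simp: ESj.smult_closed)
    with 0 triv[of "Suc j"] have "c = l \<odot>\<^bsub>E (Suc j)\<^esub> d j \<zero>\<^bsub>E j\<^esub>" by auto
    then show ?case by blast
  next
    case (Suc k)
    show ?case
      \<comment> \<open>The induction hypothesis at \<open>Suc j\<close> supplies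
        \<open>factor\<close>. Exactness gives both preimages under \<open>d j\<close> and the
        vanishing of consecutive differentials.\<close>
      by (rule factor_through_loop_step[OF inj E d,
          where e = "d (Suc (Suc j))" and G = "E (Suc (Suc (Suc j)))"])
        (use Suc ex[of j] ex[of "Suc j"] in auto)
  qed
  \<comment> \<open>In degree 0 the augmentation takes the place of the incoming
    differential.\<close>
  have "\<exists>b\<in>carrier ?M. \<epsilon> \<alpha> = l \<odot>\<^bsub>E 0\<^esub> \<epsilon> b"
  proof (rule factor_through_loop_step[OF inj E d,
        where e = "d (Suc 0)" and G = "E (Suc (Suc 0))"])
    show "\<epsilon> \<alpha> \<in> carrier (E 0)" "d 0 (\<epsilon> \<alpha>) = \<zero>\<^bsub>E (Suc 0)\<^esub>"
      using ex0 \<alpha> by (auto simp: regular_module_def)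
    fix r assume r: "r \<in> J"
    have "r \<odot>\<^bsub>E 0\<^esub> \<epsilon> \<alpha> = \<epsilon> (r \<odot>\<^bsub>?M\<^esub> \<alpha>)"
      using r \<alpha> by (intro left_module_homD(3)[OF \<epsilon>(1), symmetric]) (auto simp: regular_module_def)
    also have "\<dots> = \<epsilon> \<zero>\<^bsub>?M\<^esub>"
      using r \<alpha> by (simp add: regular_module_def)
    also have "\<dots> = \<zero>\<^bsub>E 0\<^esub>"
      by (rule left_module_hom_zero[OF M E \<epsilon>(1)])
    finally show "r \<odot>\<^bsub>E 0\<^esub> \<epsilon> \<alpha> = \<zero>\<^bsub>E 0\<^esub>" .
  qed (use factor[of 0 n] ex0 ex[of 0] in auto)
  then obtain b where b: "b \<in> carrier R" "\<epsilon> \<alpha> = l \<odot>\<^bsub>E 0\<^esub> \<epsilon> b"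
    by (auto simp: regular_module_def)
  have "l \<odot>\<^bsub>E 0\<^esub> \<epsilon> b = \<epsilon> (l \<odot>\<^bsub>?M\<^esub> b)"
    using b l_mem by (intro left_module_homD(3)[OF \<epsilon>(1), symmetric]) (auto simp: regular_module_def)
  with b have "\<epsilon> \<alpha> = \<epsilon> (l \<otimes> b)" by (simp add: regular_module_def)
  then have "\<alpha> = l \<otimes> b"
    using \<alpha> b l_mem by (intro inj_onD[OF \<epsilon>(2)]) (auto simp: regular_module_def)
  with b show ?thesis by blast
qed

end

section \<open>The simple module at the base of a loop\<close>

lemma opposite_ring_simps [simp]:
  "carrier (opposite_ring R) = carrier R"
  "x \<otimes>\<^bsub>opposite_ring R\<^esub> y = y \<otimes>\<^bsub>R\<^esub> x"
  "\<one>\<^bsub>opposite_ring R\<^esub> = \<one>\<^bsub>R\<^esub>"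
  "x \<oplus>\<^bsub>opposite_ring R\<^esub> y = x \<oplus>\<^bsub>R\<^esub> y"
  "\<zero>\<^bsub>opposite_ring R\<^esub> = \<zero>\<^bsub>R\<^esub>"
  by (simp_all add: opposite_ring_def)

lemma a_minus_opposite_ring [simp]: "x \<ominus>\<^bsub>opposite_ring R\<^esub> y = x \<ominus>\<^bsub>R\<^esub> y"
  by (simp add: a_minus_def a_inv_def opposite_ring_def)

lemma additive_subgroup_opposite_ring [simp]:
  "additive_subgroup J (opposite_ring R) = additive_subgroup J R"
  by (simp add: additive_subgroup_def opposite_ring_def)

section \<open>Coefficients of products at paths of length at most one\<close>

lemma lookup_path_mult_trivial:
  "Poly_Mapping.lookup (path_mult Q f g) (u, []) =
    Poly_Mapping.lookup f (u, []) * Poly_Mapping.lookup g (u, [])"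
proof (induction f rule: poly_mapping_additive_induct)
  case (single p a)
  show ?case
  proof (induction g rule: poly_mapping_additive_induct)
    case (single q b)
    show ?case
      by (cases p; cases q)
        (auto simp: path_mult_single Poly_Mapping.lookup_single when_def path_target_def
          pre_digraph.awalk_verts.simps)
  qed (auto simp: path_mult_add_right Poly_Mapping.lookup_add distrib_left)
qed (auto simp: path_mult_add_left Poly_Mapping.lookup_add distrib_right)

text \<open>An arrow factors only as itself times the trivial path at one of its ends, whence this
  Leibniz rule, twisted by the two end vertices.\<close>

lemma lookup_path_mult_arrow:
  "Poly_Mapping.lookup (path_mult Q f g) (tail Q a, [a]) =
    Poly_Mapping.lookup f (tail Q a, []) * Poly_Mapping.lookup g (tail Q a, [a]) +
    Poly_Mapping.lookup f (tail Q a, [a]) * Poly_Mapping.lookup g (head Q a, [])"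
proof (induction f rule: poly_mapping_additive_induct)
  case (single p b)
  show ?case
  proof (induction g rule: poly_mapping_additive_induct)
    case (single q c)
    show ?case
      by (cases p; cases q)
        (auto simp: path_mult_single Poly_Mapping.lookup_single when_def path_target_def
          pre_digraph.awalk_verts.simps append_eq_Cons_conv)
  qed (auto simp: path_mult_add_right Poly_Mapping.lookup_add algebra_simps)
qed (auto simp: path_mult_add_left Poly_Mapping.lookup_add algebra_simps)

text \<open>The choice of representative is harmless only for paths of length below 2, which
  admissibility keeps out of the elements of \<open>I\<close>.\<close>

definition coset_coeff :: "('v, 'e) path \<Rightarrow> (('v, 'e) path \<Rightarrow>\<^sub>0 'k::field) set \<Rightarrow> 'k"
  where "coset_coeff p X = Poly_Mapping.lookup (SOME f. f \<in> X) p"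

section \<open>Arithmetic and coefficients in the bound quiver algebra\<close>

locale loop_quiver =
  fixes Q :: "('v, 'e) pre_digraph"
    and I :: "(('v, 'e) path \<Rightarrow>\<^sub>0 'k::field) set"
    and l :: 'e and i :: 'v
  assumes fin: "fin_digraph Q"
    and admissible: "admissible_ideal Q I"
    and loop: "squared_zero_loop Q I l i"
begin

interpretation Q: fin_digraph Q by (rule fin)

abbreviation "A \<equiv> path_algebra Q :: (('v, 'e) path \<Rightarrow>\<^sub>0 'k) ring"
abbreviation "\<Lambda> \<equiv> bound_quiver_algebra Q I"

interpretation I: ideal I A
  using admissible by (simp add: admissible_ideal_def)

interpretation \<Lambda>: ring \<Lambda>
  by (rule I.quotient_is_ring)

lemma loop_simps: "l \<in> arcs Q" "tail Q l = i" "head Q l = i" "i \<in> verts Q"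
  and loop_sq: "path_mult Q (arrow Q l) (arrow Q l) \<in> I"
  using loop by (auto simp: squared_zero_loop_def path_algebra_def)

lemma path_algebra_simps:
  "f \<in> carrier A \<longleftrightarrow> Poly_Mapping.keys f \<subseteq> paths Q"
  "f \<otimes>\<^bsub>A\<^esub> g = path_mult Q f g" "f \<oplus>\<^bsub>A\<^esub> g = f + g" "\<zero>\<^bsub>A\<^esub> = 0"
  by (simp_all add: path_algebra_def)

lemma zero_mem: "0 \<in> I" and add_mem: "f \<in> I \<Longrightarrow> g \<in> I \<Longrightarrow> f + g \<in> I"
  using additive_subgroup.zero_closed[OF I.is_additive_subgroup]
    additive_subgroup.a_closed[OF I.is_additive_subgroup]
  by (simp_all add: path_algebra_simps)

lemma trivial_path_mem: "v \<in> verts Q \<Longrightarrow> Poly_Mapping.single (v, []) t \<in> carrier A"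
  by (auto simp: path_algebra_simps paths_def Q.awalk_def)

lemma arrow_mem: "a \<in> arcs Q \<Longrightarrow> arrow Q a \<in> carrier A"
  by (auto simp: path_algebra_simps paths_def Q.awalk_def arrow_def)

lemma quotient_cases:
  assumes "X \<in> carrier \<Lambda>" obtains f where "f \<in> carrier A" "X = I +>\<^bsub>A\<^esub> f"
  using assms by (auto simp: FactRing_def A_RCOSETS_def')

lemma quotient_closed: "f \<in> carrier A \<Longrightarrow> I +>\<^bsub>A\<^esub> f \<in> carrier \<Lambda>"
  by (auto simp: FactRing_def A_RCOSETS_def')

lemma quotient_simps:
  assumes "f \<in> carrier A" "g \<in> carrier A"
  shows "(I +>\<^bsub>A\<^esub> f) \<otimes>\<^bsub>\<Lambda>\<^esub> (I +>\<^bsub>A\<^esub> g) = I +>\<^bsub>A\<^esub> path_mult Q f g"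
    and "(I +>\<^bsub>A\<^esub> f) \<oplus>\<^bsub>\<Lambda>\<^esub> (I +>\<^bsub>A\<^esub> g) = I +>\<^bsub>A\<^esub> (f + g)"
  using assms I.rcoset_mult_add[of f g] I.a_rcos_sum[of f g]
  by (auto simp: FactRing_def A_RCOSETS_def' path_algebra_simps)

lemma quotient_zero_iff: "f \<in> carrier A \<Longrightarrow> I +>\<^bsub>A\<^esub> f = \<zero>\<^bsub>\<Lambda>\<^esub> \<longleftrightarrow> f \<in> I"
  using I.a_rcos_self[of f] I.a_rcos_const[of f] by (auto simp: FactRing_def)

lemma quotient_a_inv: "f \<in> carrier A \<Longrightarrow> \<ominus>\<^bsub>\<Lambda>\<^esub> (I +>\<^bsub>A\<^esub> f) = I +>\<^bsub>A\<^esub> (- f)"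
  using quotient_zero_iff[of 0] zero_mem
  by (intro \<Lambda>.minus_equality) (auto simp: quotient_simps quotient_closed path_algebra_simps)

text \<open>Two representatives differ by an element of \<open>I\<close>, whose paths all have
  length at least 2.\<close>

lemma coset_coeff_coset:
  assumes "f \<in> carrier A" "path_length p < 2"
  shows "coset_coeff p (I +>\<^bsub>A\<^esub> f) = Poly_Mapping.lookup f p"
proof -
  have "(SOME g. g \<in> I +>\<^bsub>A\<^esub> f) \<in> I +>\<^bsub>A\<^esub> f"
    using I.a_rcos_self[OF assms(1)] by (rule someI)
  then obtain h where h: "h \<in> I" "(SOME g. g \<in> I +>\<^bsub>A\<^esub> f) = h + f"
    by (auto simp: a_r_coset_def' path_algebra_simps)
  then have "\<forall>p\<in>Poly_Mapping.keys h. 2 \<le> path_length p"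
    using admissible unfolding admissible_ideal_def by blast
  then have "p \<notin> Poly_Mapping.keys h"
    using assms(2) by fastforce
  with h show ?thesis
    by (simp add: coset_coeff_def Poly_Mapping.lookup_add in_keys_iff)
qed

lemma coset_coeff_add:
  assumes "X \<in> carrier \<Lambda>" "Y \<in> carrier \<Lambda>" "path_length p < 2"
  shows "coset_coeff p (X \<oplus>\<^bsub>\<Lambda>\<^esub> Y) = coset_coeff p X + coset_coeff p Y"
proof -
  obtain f g where "f \<in> carrier A" "X = I +>\<^bsub>A\<^esub> f" "g \<in> carrier A" "Y = I +>\<^bsub>A\<^esub> g"
    using assms quotient_cases by metis
  with assms(3) I.a_closed[of f g] show ?thesis
    by (simp add: quotient_simps coset_coeff_coset path_algebra_simps(3) Poly_Mapping.lookup_add)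
qed

lemma coset_coeff_a_inv:
  assumes "X \<in> carrier \<Lambda>" "path_length p < 2"
  shows "coset_coeff p (\<ominus>\<^bsub>\<Lambda>\<^esub> X) = - coset_coeff p X"
proof -
  obtain f where "f \<in> carrier A" "X = I +>\<^bsub>A\<^esub> f"
    using assms quotient_cases by metis
  with assms(2) show ?thesis
    by (simp add: quotient_a_inv coset_coeff_coset path_algebra_simps(1))
qed

lemma coset_coeff_mult:
  assumes "X \<in> carrier \<Lambda>" "Y \<in> carrier \<Lambda>"
  shows "coset_coeff (u, []) (X \<otimes>\<^bsub>\<Lambda>\<^esub> Y) = coset_coeff (u, []) X * coset_coeff (u, []) Y"
    and "coset_coeff (tail Q a, [a]) (X \<otimes>\<^bsub>\<Lambda>\<^esub> Y) =
      coset_coeff (tail Q a, []) X * coset_coeff (tail Q a, [a]) Y +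
      coset_coeff (tail Q a, [a]) X * coset_coeff (head Q a, []) Y"
proof -
  obtain f g where fg: "f \<in> carrier A" "X = I +>\<^bsub>A\<^esub> f" "g \<in> carrier A" "Y = I +>\<^bsub>A\<^esub> g"
    using assms quotient_cases by metis
  moreover have "path_mult Q f g \<in> carrier A"
    using fg I.m_closed[of f g] by (simp add: path_algebra_simps(2))
  ultimately show "coset_coeff (u, []) (X \<otimes>\<^bsub>\<Lambda>\<^esub> Y) = coset_coeff (u, []) X * coset_coeff (u, []) Y"
    and "coset_coeff (tail Q a, [a]) (X \<otimes>\<^bsub>\<Lambda>\<^esub> Y) =
      coset_coeff (tail Q a, []) X * coset_coeff (tail Q a, [a]) Y +
      coset_coeff (tail Q a, [a]) X * coset_coeff (head Q a, []) Y"
    by (simp_all add: quotient_simps(1) coset_coeff_coset path_length_def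
        lookup_path_mult_trivial lookup_path_mult_arrow)
qed

section \<open>The self-extension given by the loop\<close>

definition J :: "(('v, 'e) path \<Rightarrow>\<^sub>0 'k) set set"
  where "J = {X \<in> carrier \<Lambda>. coset_coeff (i, []) X = 0}"

text \<open>The coefficient at \<open>(i, [])\<close> identifies \<open>\<Lambda> / J\<close> with
  the field, and a scalar is lifted back as a multiple of that trivial path. Reading off the
  coefficient of \<open>l\<close> sends the loop to 1 modulo \<open>J\<close>.\<close>

definition \<phi> :: "(('v, 'e) path \<Rightarrow>\<^sub>0 'k) set \<Rightarrow> (('v, 'e) path \<Rightarrow>\<^sub>0 'k) set"
  where "\<phi> X = I +>\<^bsub>A\<^esub> Poly_Mapping.single (i, []) (coset_coeff (i, [l]) X)"

abbreviation "L \<equiv> I +>\<^bsub>A\<^esub> arrow Q l"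

lemma phi_closed: "\<phi> X \<in> carrier \<Lambda>"
  by (simp add: \<phi>_def quotient_closed trivial_path_mem loop_simps)

lemma phi_add:
  assumes "X \<in> carrier \<Lambda>" "Y \<in> carrier \<Lambda>" shows "\<phi> (X \<oplus>\<^bsub>\<Lambda>\<^esub> Y) = \<phi> X \<oplus>\<^bsub>\<Lambda>\<^esub> \<phi> Y"
  using assms
  by (simp add: \<phi>_def quotient_simps trivial_path_mem loop_simps coset_coeff_add path_length_def
      flip: Poly_Mapping.single_add)

lemma coset_coeff_phi: "coset_coeff (i, []) (\<phi> X) = coset_coeff (i, [l]) X"
  by (simp add: \<phi>_def coset_coeff_coset trivial_path_mem loop_simps path_length_def)

lemma L_closed: "L \<in> carrier \<Lambda>"
  by (simp add: quotient_closed arrow_mem loop_simps)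

lemma coset_coeff_arrow:
  assumes "a \<in> arcs Q" "path_length p < 2"
  shows "coset_coeff p (I +>\<^bsub>A\<^esub> arrow Q a) = (if p = (tail Q a, [a]) then 1 else 0)"
  using assms by (simp add: coset_coeff_coset arrow_mem) (simp add: arrow_def Poly_Mapping.lookup_single when_def)

text \<open>Comparing coefficients of the loop in \<open>\<one> L = L\<close> gives the value
  without evaluating the sum over vertices that defines the unit.\<close>

lemma coset_coeff_one: "coset_coeff (i, []) \<one>\<^bsub>\<Lambda>\<^esub> = 1"
proof -
  have "coset_coeff (i, [l]) (\<one>\<^bsub>\<Lambda>\<^esub> \<otimes>\<^bsub>\<Lambda>\<^esub> L) = coset_coeff (i, []) \<one>\<^bsub>\<Lambda>\<^esub>"
    using coset_coeff_mult(2)[OF \<Lambda>.one_closed L_closed, of l]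
    by (simp add: loop_simps coset_coeff_arrow path_length_def)
  then show ?thesis
    using L_closed by (simp add: loop_simps coset_coeff_arrow path_length_def)
qed

lemma J_add_subgroup: "additive_subgroup J \<Lambda>"
proof (rule additive_subgroupI)
  have "coset_coeff (i, []) \<zero>\<^bsub>\<Lambda>\<^esub> = (0 :: 'k)"
    using quotient_zero_iff[of 0] zero_mem coset_coeff_coset[of 0 "(i, [])"]
    by (simp add: path_algebra_simps path_length_def)
  then have "\<zero>\<^bsub>\<Lambda>\<^esub> \<in> J" by (simp add: J_def)
  moreover have "inv\<^bsub>add_monoid \<Lambda>\<^esub> X = \<ominus>\<^bsub>\<Lambda>\<^esub> X" for X
    by (simp add: a_inv_def)
  ultimately show "subgroup J (add_monoid \<Lambda>)"
    by (intro group.subgroupI \<Lambda>.a_group)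
      (auto simp: J_def coset_coeff_add coset_coeff_a_inv path_length_def)
qed

lemma L_sq: "L \<otimes>\<^bsub>\<Lambda>\<^esub> L = \<zero>\<^bsub>\<Lambda>\<^esub>"
proof -
  have "path_mult Q (arrow Q l) (arrow Q l) \<in> carrier A"
    using loop_sq I.a_subset by blast
  then show ?thesis
    using loop_sq by (simp add: quotient_simps arrow_mem loop_simps quotient_zero_iff)
qed

lemma L_mem: "L \<in> J"
  by (simp add: J_def L_closed coset_coeff_arrow loop_simps path_length_def)

lemma phi_L: "\<phi> L \<ominus>\<^bsub>\<Lambda>\<^esub> \<one>\<^bsub>\<Lambda>\<^esub> \<in> J"
  by (simp add: J_def a_minus_def coset_coeff_add coset_coeff_a_inv phi_closed coset_coeff_phi
      coset_coeff_one coset_coeff_arrow loop_simps path_length_def)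

text \<open>In the Leibniz rule at \<open>l\<close>, both of whose ends are \<open>i\<close>, one
  term contains the coefficient of the right factor at \<open>(i, [])\<close>, which vanishes on
  \<open>J\<close>. What remains is linearity of \<open>\<phi>\<close> modulo
  \<open>J\<close>.\<close>

lemma self_extension: "self_extension \<Lambda> J L \<phi>"
proof (intro self_extension.intro left_ideal.intro left_ideal_axioms.intro
    self_extension_axioms.intro \<Lambda>.ring_axioms J_add_subgroup L_sq L_mem phi_L phi_closed)
  fix X Y assume "X \<in> carrier \<Lambda>" "Y \<in> J"
  then show "X \<otimes>\<^bsub>\<Lambda>\<^esub> Y \<in> J" "\<phi> (X \<otimes>\<^bsub>\<Lambda>\<^esub> Y) \<ominus>\<^bsub>\<Lambda>\<^esub> X \<otimes>\<^bsub>\<Lambda>\<^esub> \<phi> Y \<in> J"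
    using coset_coeff_mult(2)[of X Y l]
    by (simp_all add: J_def coset_coeff_mult(1) a_minus_def coset_coeff_add coset_coeff_a_inv
        phi_closed coset_coeff_phi loop_simps path_length_def)
qed (auto simp: J_def phi_add)

text \<open>Since the loop begins and ends at \<open>i\<close>, the Leibniz rule is symmetric in the
  two factors, and \<open>J\<close> is closed under multiplication from both sides. Hence the same
  data serve right modules.\<close>

lemma self_extension_opposite: "self_extension (opposite_ring \<Lambda>) J L \<phi>"
proof (intro self_extension.intro left_ideal.intro left_ideal_axioms.intro
    self_extension_axioms.intro ring_opposite_ring \<Lambda>.ring_axioms)
  fix X Y assume "X \<in> carrier (opposite_ring \<Lambda>)" "Y \<in> J"
  then show "X \<otimes>\<^bsub>opposite_ring \<Lambda>\<^esub> Y \<in> J"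
    "\<phi> (X \<otimes>\<^bsub>opposite_ring \<Lambda>\<^esub> Y) \<ominus>\<^bsub>opposite_ring \<Lambda>\<^esub> X \<otimes>\<^bsub>opposite_ring \<Lambda>\<^esub> \<phi> Y \<in> J"
    using coset_coeff_mult(2)[of Y X l]
    by (simp_all add: J_def coset_coeff_mult(1) a_minus_def[of \<Lambda>] coset_coeff_add coset_coeff_a_inv
        phi_closed coset_coeff_phi loop_simps path_length_def)
qed (simp_all add: J_add_subgroup L_mem L_sq phi_L phi_closed, auto simp: J_def phi_add)

section \<open>Arrows annihilated by the maximal ideal\<close>

lemma J_cases:
  assumes "X \<in> J"
  obtains f where "f \<in> carrier A" "X = I +>\<^bsub>A\<^esub> f" "Poly_Mapping.lookup f (i, []) = 0"
proof -
  obtain f where f: "f \<in> carrier A" "X = I +>\<^bsub>A\<^esub> f"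
    using assms quotient_cases by (auto simp: J_def)
  then have "Poly_Mapping.lookup f (i, []) = coset_coeff (i, []) X"
    by (simp add: coset_coeff_coset path_length_def)
  with f assms that show thesis by (simp add: J_def)
qed

text \<open>A path other than \<open>(i, [])\<close> is either trivial at another vertex, so that
  \<open>\<alpha>\<close> does not compose with it, or it begins with an arrow that
  \<open>\<alpha>\<close> multiplies into \<open>I\<close>.\<close>

lemma arrow_mult_J:
  assumes "\<alpha> \<in> arcs Q" "head Q \<alpha> = i"
    and kill: "\<And>\<beta>. \<beta> \<in> arcs Q \<Longrightarrow> path_mult Q (arrow Q \<alpha>) (arrow Q \<beta>) \<in> I"
    and "X \<in> J"
  shows "(I +>\<^bsub>A\<^esub> arrow Q \<alpha>) \<otimes>\<^bsub>\<Lambda>\<^esub> X = \<zero>\<^bsub>\<Lambda>\<^esub>"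
proof -
  obtain f where f: "f \<in> carrier A" "X = I +>\<^bsub>A\<^esub> f" "Poly_Mapping.lookup f (i, []) = 0"
    using J_cases[OF assms(4)] .
  have "path_mult Q (arrow Q \<alpha>) f \<in> I"
  proof (induction f rule: poly_mapping_additive_induct)
    case zero
    show ?case by (simp add: zero_mem)
  next
    case (add f g)
    then show ?case
      by (simp add: path_mult_add_right add_mem)
  next
    case (single p a)
    then have p: "p \<in> paths Q" "p \<noteq> (i, [])"
      using f by (auto simp: path_algebra_simps in_keys_iff)
    show ?case
    proof (cases "snd p")
      case Nil
      then have "fst p \<noteq> i" using p by (cases p) auto
      then show ?thesis
        using assms(2) Nil
        by (simp add: arrow_def path_mult_single path_target_def zero_mem
            pre_digraph.awalk_verts.simps)
    next
      case (Cons \<beta> xs)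
      then have \<beta>: "\<beta> \<in> arcs Q" "fst p = tail Q \<beta>" "(head Q \<beta>, xs) \<in> paths Q"
        using p by (auto simp: paths_def Q.awalk_def)
      \<comment> \<open>The first arrow is split off; \<open>kill\<close> applies to it whatever its
        source, and \<open>I\<close> absorbs the remaining path from the right.\<close>
      let ?g = "Poly_Mapping.single (head Q \<beta>, xs) a"
      have "Poly_Mapping.single p a = path_mult Q (arrow Q \<beta>) ?g"
        using \<beta> Cons by (cases p) (simp add: arrow_def path_mult_single path_target_def
            pre_digraph.awalk_verts.simps)
      moreover have "?g \<in> carrier A"
        using \<beta> by (auto simp: path_algebra_simps)
      ultimately show ?thesis
        using I.I_r_closed[OF kill[OF \<beta>(1)], of ?g] by (simp add: path_mult_assoc path_algebra_simps(2))
    qed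
  qed
  moreover from this have "path_mult Q (arrow Q \<alpha>) f \<in> carrier A"
    using I.a_subset by blast
  ultimately show ?thesis
    using f assms(1) by (simp add: quotient_simps(1) arrow_mem quotient_zero_iff)
qed

text \<open>Mirror image of \<open>arrow_mult_J\<close>: the last arrow of a path is split off, and
  \<open>I\<close> absorbs the rest from the left.\<close>

lemma J_mult_arrow:
  assumes "\<gamma> \<in> arcs Q" "tail Q \<gamma> = i"
    and kill: "\<And>\<beta>. \<beta> \<in> arcs Q \<Longrightarrow> path_mult Q (arrow Q \<beta>) (arrow Q \<gamma>) \<in> I"
    and "X \<in> J"
  shows "X \<otimes>\<^bsub>\<Lambda>\<^esub> (I +>\<^bsub>A\<^esub> arrow Q \<gamma>) = \<zero>\<^bsub>\<Lambda>\<^esub>"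
proof -
  obtain f where f: "f \<in> carrier A" "X = I +>\<^bsub>A\<^esub> f" "Poly_Mapping.lookup f (i, []) = 0"
    using J_cases[OF assms(4)] .
  have "path_mult Q f (arrow Q \<gamma>) \<in> I"
  proof (induction f rule: poly_mapping_additive_induct)
    case zero
    show ?case by (simp add: zero_mem)
  next
    case (add f g)
    then show ?case
      by (simp add: path_mult_add_left add_mem)
  next
    case (single p a)
    then have p: "p \<in> paths Q" "p \<noteq> (i, [])"
      using f by (auto simp: path_algebra_simps in_keys_iff)
    show ?case
    proof (cases "snd p" rule: rev_cases)
      case Nil
      then have "fst p \<noteq> i" using p by (cases p) auto
      then show ?thesis
        using assms(2) Nil
        by (cases p) (simp add: arrow_def path_mult_single path_target_def zero_mem
            pre_digraph.awalk_verts.simps)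
    next
      case (snoc xs \<beta>)
      have "\<exists>v. Q.awalk (fst p) (snd p) v"
        using p(1) by (auto simp: paths_def)
      then obtain v where "Q.awalk (fst p) (xs @ [\<beta>]) v"
        unfolding snoc by blast
      then have \<beta>: "\<beta> \<in> arcs Q" "Q.awalk (fst p) xs (tail Q \<beta>)"
        by (auto simp: Q.awalk_append_iff Q.awalk_simps)
      let ?g = "Poly_Mapping.single (fst p, xs) a"
      have "Poly_Mapping.single p a = path_mult Q ?g (arrow Q \<beta>)"
        using \<beta> snoc by (cases p) (auto simp: arrow_def path_mult_single path_target_def)
      moreover have "?g \<in> carrier A"
        using \<beta> by (auto simp: path_algebra_simps paths_def)
      ultimately show ?thesis
        using I.I_l_closed[OF kill[OF \<beta>(1)], of ?g] by (simp add: path_mult_assoc path_algebra_simps(2))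
    qed
  qed
  moreover from this have "path_mult Q f (arrow Q \<gamma>) \<in> carrier A"
    using I.a_subset by blast
  ultimately show ?thesis
    using f assms(1) by (simp add: quotient_simps(1) arrow_mem quotient_zero_iff)
qed

text \<open>In the opposite ring \<open>J\<close> kills the coset of \<open>\<alpha>\<close>, so
  finite dimension would make that coset a multiple \<open>X L\<close> of the loop. Its coefficient
  at \<open>\<alpha>\<close> forbids this.\<close>

lemma right_injective_dimension_infinite:
  assumes "\<alpha> \<in> arcs Q" "\<alpha> \<noteq> l" "head Q \<alpha> = i"
    and "\<And>\<beta>. \<beta> \<in> arcs Q \<Longrightarrow> path_mult Q (arrow Q \<alpha>) (arrow Q \<beta>) \<in> I"
  shows "\<not> injective_dimension TYPE('m) (opposite_ring \<Lambda>) (regular_module (opposite_ring \<Lambda>)) < \<infinity>"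
proof
  assume "injective_dimension TYPE('m) (opposite_ring \<Lambda>) (regular_module (opposite_ring \<Lambda>)) < \<infinity>"
  then obtain X where X: "X \<in> carrier \<Lambda>" "I +>\<^bsub>A\<^esub> arrow Q \<alpha> = X \<otimes>\<^bsub>\<Lambda>\<^esub> L"
    using self_extension.injective_dimension_finite_imp_factor[OF self_extension_opposite,
        of "I +>\<^bsub>A\<^esub> arrow Q \<alpha>"] arrow_mult_J[OF assms(1,3,4)] assms(1)
    by (metis opposite_ring_simps(1,2,5) quotient_closed arrow_mem)
  \<comment> \<open>Each term of the Leibniz rule contains a coefficient of \<open>L\<close> at
    \<open>\<alpha>\<close> or at a trivial path, and both are zero because
    \<open>\<alpha> \<noteq> l\<close>.\<close>
  then have "coset_coeff (tail Q \<alpha>, [\<alpha>]) (I +>\<^bsub>A\<^esub> arrow Q \<alpha>) = (0 :: 'k)"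
    using assms(2) by (simp add: coset_coeff_mult(2) L_closed coset_coeff_arrow loop_simps path_length_def)
  then show False
    using assms(1) by (simp add: coset_coeff_arrow path_length_def)
qed

text \<open>The same comparison of coefficients over \<open>\<Lambda>\<close> itself, with the loop
  now as the left factor.\<close>

lemma left_injective_dimension_infinite:
  assumes "\<gamma> \<in> arcs Q" "\<gamma> \<noteq> l" "tail Q \<gamma> = i"
    and "\<And>\<beta>. \<beta> \<in> arcs Q \<Longrightarrow> path_mult Q (arrow Q \<beta>) (arrow Q \<gamma>) \<in> I"
  shows "\<not> injective_dimension TYPE('m) \<Lambda> (regular_module \<Lambda>) < \<infinity>"
proof
  assume "injective_dimension TYPE('m) \<Lambda> (regular_module \<Lambda>) < \<infinity>"
  then obtain X where X: "X \<in> carrier \<Lambda>" "I +>\<^bsub>A\<^esub> arrow Q \<gamma> = L \<otimes>\<^bsub>\<Lambda>\<^esub> X"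
    using self_extension.injective_dimension_finite_imp_factor[OF self_extension,
        of "I +>\<^bsub>A\<^esub> arrow Q \<gamma>"] J_mult_arrow[OF assms(1,3,4)] assms(1)
    by (metis quotient_closed arrow_mem)
  then have "coset_coeff (tail Q \<gamma>, [\<gamma>]) (I +>\<^bsub>A\<^esub> arrow Q \<gamma>) = (0 :: 'k)"
    using assms(2) by (simp add: coset_coeff_mult(2) L_closed coset_coeff_arrow loop_simps path_length_def)
  then show False
    using assms(1) by (simp add: coset_coeff_arrow path_length_def)
qed

end

theorem corollary4p14:
  fixes Q :: "('v, 'e) pre_digraph"
    and I :: "(('v, 'e) path \<Rightarrow>\<^sub>0 'k::field) set"
    and l :: 'e and i :: 'v
  assumes "fin_digraph Q"
    and "admissible_ideal Q I"
    and "squared_zero_loop Q I l i"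
  shows "((\<exists>\<alpha>\<in>arcs Q. \<alpha> \<noteq> l \<and> head Q \<alpha> = i \<and>
            (\<forall>\<beta>\<in>arcs Q. arrow Q \<alpha> \<otimes>\<^bsub>path_algebra Q\<^esub> arrow Q \<beta> \<in> I)) \<longrightarrow>
          \<not> iwanaga_gorenstein TYPE('m) (bound_quiver_algebra Q I)) \<and>
         ((\<exists>\<gamma>\<in>arcs Q. \<gamma> \<noteq> l \<and> tail Q \<gamma> = i \<and>
            (\<forall>\<beta>\<in>arcs Q. arrow Q \<beta> \<otimes>\<^bsub>path_algebra Q\<^esub> arrow Q \<gamma> \<in> I)) \<longrightarrow>
          \<not> iwanaga_gorenstein TYPE('m) (bound_quiver_algebra Q I))"
proof -
  interpret loop_quiver Q I l i
    using assms by (rule loop_quiver.intro)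
  show ?thesis
    \<comment> \<open>\<open>\<alpha>\<close> refutes finiteness on the right and
      \<open>\<gamma>\<close> on the left; either contradicts the conjunction.\<close>
    using right_injective_dimension_infinite left_injective_dimension_infinite
    unfolding iwanaga_gorenstein_def path_algebra_simps(2) by blast
qed

end
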